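(* Let $p>3$ be a prime. Then $$\sum_{k=0}^{[p/3]}\frac{\binom{3k}k}{27^k}\equiv\begin{cases}1\pmod p&\text{if }p\equiv\pm1\pmod 9,\\ -1\pmod p&\text{if }p\equiv\pm2\pmod9,\\ 0\pmod p&\text{if }p\equiv\pm4\pmod9.\end{cases}$$
   Context: $[x]$ is the greatest integer not exceeding $x$. *)

theory Defs
  imports "HOL-Number_Theory.Number_Theory"
begin

definition p_integral :: "nat \<Rightarrow> rat \<Rightarrow> bool" where
  "p_integral p x \<longleftrightarrow> coprime (snd (quotient_of x)) (int p)"

text \<open>
  Congruence modulo \<open>p\<close> in the ring of rationals with denominator prime to \<open>p\<close>.
  The library congruence does not serve here: on the field \<^typ>\<open>rat\<close>, divisibility
  by a nonzero number is always true.
\<close>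

definition rat_cong :: "rat \<Rightarrow> rat \<Rightarrow> nat \<Rightarrow> bool" where
  "rat_cong x y p \<longleftrightarrow>
     p_integral p x \<and> p_integral p y \<and> (\<exists>z. p_integral p z \<and> x - y = of_nat p * z)"

end

theory Submission
  imports Defs
begin

text \<open>
  Write \<open>n = [p/3]\<close>, so that \<open>3n \<equiv> -1\<close> or \<open>3n \<equiv> -2\<close> modulo \<open>p\<close>. For \<open>k \<le> n\<close> the consecutive
  quotients of \<open>binom(3k,k)\<close> and of \<open>(-27)^k binom(n+k,2k)\<close> agree modulo \<open>p\<close>, and hence the sum
  is congruent to \<open>a\<^sub>n = \<Sum>\<^sub>k (-1)^k binom(n+k,2k)\<close>. With
  \<open>b\<^sub>n = \<Sum>\<^sub>k (-1)^k binom(n+k+1,2k+1)\<close>, Pascal's rule gives \<open>a\<^sub>n\<^sub>+\<^sub>1 = a\<^sub>n - b\<^sub>n\<close> and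
  \<open>b\<^sub>n\<^sub>+\<^sub>1 = a\<^sub>n\<close>. So \<open>a\<close> runs through \<open>1, 0, -1, -1, 0, 1\<close> with period 6, and the residue of
  \<open>n\<close> modulo 6 is determined by that of the odd number \<open>p\<close> modulo 9.
\<close>

section \<open>Two alternating binomial sums and their period\<close>

definition alt_even_binomial_sum :: "nat \<Rightarrow> int" where
  "alt_even_binomial_sum n = (\<Sum>k\<le>n. (- 1) ^ k * int ((n + k) choose (2 * k)))"

definition alt_odd_binomial_sum :: "nat \<Rightarrow> int" where
  "alt_odd_binomial_sum n = (\<Sum>k\<le>n. (- 1) ^ k * int ((n + k + 1) choose (2 * k + 1)))"

lemma alt_even_binomial_sum_Suc:
  "alt_even_binomial_sum (Suc n) = alt_even_binomial_sum n - alt_odd_binomial_sum n"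
proof -
  have "alt_even_binomial_sum (Suc n) =
          1 + (\<Sum>k\<le>n. (- 1) ^ Suc k * int ((n + k + 2) choose (2 * k + 2)))"
    unfolding alt_even_binomial_sum_def by (subst sum.atMost_Suc_shift) simp
  \<comment> \<open>Pascal's rule, applied to \<open>(n + k + 2) choose (2 * k + 2)\<close>.\<close>
  also have "\<dots> = 1 + (\<Sum>k\<le>n. (- 1) ^ Suc k * int ((n + k + 1) choose (2 * k + 2)))
                    - alt_odd_binomial_sum n"
    unfolding alt_odd_binomial_sum_def add_diff_eq [symmetric] sum_subtractf [symmetric]
    by (intro arg_cong2 [of _ _ _ _ "(+)"] sum.cong) (simp_all add: algebra_simps)
  also have "1 + (\<Sum>k\<le>n. (- 1) ^ Suc k * int ((n + k + 1) choose (2 * k + 2))) =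
               (\<Sum>k\<le>Suc n. (- 1) ^ k * int ((n + k) choose (2 * k)))"
    by (subst sum.atMost_Suc_shift) simp
  \<comment> \<open>The top term \<open>k = Suc n\<close> is zero, being
    \<open>(2 * n + 1) choose (2 * n + 2)\<close>.\<close>
  also have "\<dots> = alt_even_binomial_sum n"
    unfolding alt_even_binomial_sum_def by (simp add: binomial_eq_0)
  finally show ?thesis .
qed

text \<open>Pascal's rule alone yields \<open>a\<^sub>n\<^sub>+\<^sub>1 + b\<^sub>n\<close> on the
  right; the preceding recurrence then cancels \<open>b\<^sub>n\<close>.\<close>

lemma alt_odd_binomial_sum_Suc:
  "alt_odd_binomial_sum (Suc n) = alt_even_binomial_sum n"
proof -
  have "alt_odd_binomial_sum (Suc n) = alt_even_binomial_sum (Suc n)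
          + (\<Sum>k\<le>Suc n. (- 1) ^ k * int ((n + k + 1) choose (2 * k + 1)))"
    unfolding alt_odd_binomial_sum_def alt_even_binomial_sum_def sum.distrib [symmetric]
    by (rule sum.cong) (simp_all add: algebra_simps)
  also have "(\<Sum>k\<le>Suc n. (- 1) ^ k * int ((n + k + 1) choose (2 * k + 1))) =
               alt_odd_binomial_sum n"
    unfolding alt_odd_binomial_sum_def by (simp add: binomial_eq_0)
  finally show ?thesis
    by (simp add: alt_even_binomial_sum_Suc)
qed

text \<open>Together the recurrences give \<open>a\<^sub>n\<^sub>+\<^sub>2 =
  a\<^sub>n\<^sub>+\<^sub>1 - a\<^sub>n\<close>, whose characteristic polynomial
  \<open>x^2 - x + 1\<close> divides \<open>x^6 - 1\<close>.\<close>

lemma alt_even_binomial_sum_mod_6: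
  "alt_even_binomial_sum n = alt_even_binomial_sum (n mod 6)"
proof -
  have period: "alt_even_binomial_sum (m + 6) = alt_even_binomial_sum m" for m
    by (simp add: numeral_eq_Suc alt_even_binomial_sum_Suc alt_odd_binomial_sum_Suc)
  have "alt_even_binomial_sum (r + 6 * q) = alt_even_binomial_sum r" for q r
  proof (induction q)
    case (Suc q)
    then show ?case
      using period [of "r + 6 * q"] by (simp add: algebra_simps)
  qed simp
  then show ?thesis
    by (metis mod_mult_div_eq)
qed

lemma alt_even_binomial_sum_initial_values:
  "alt_even_binomial_sum 0 = 1" "alt_even_binomial_sum 1 = 0"
  "alt_even_binomial_sum 2 = - 1" "alt_even_binomial_sum 3 = - 1"
  "alt_even_binomial_sum 4 = 0" "alt_even_binomial_sum 5 = 1"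
proof -
  have start: "alt_even_binomial_sum 0 = 1" "alt_odd_binomial_sum 0 = 1"
    by (simp_all add: alt_even_binomial_sum_def alt_odd_binomial_sum_def)
  show "alt_even_binomial_sum 0 = 1" "alt_even_binomial_sum 1 = 0"
    "alt_even_binomial_sum 2 = - 1" "alt_even_binomial_sum 3 = - 1"
    "alt_even_binomial_sum 4 = 0" "alt_even_binomial_sum 5 = 1"
    by (simp_all add: start numeral_eq_Suc alt_even_binomial_sum_Suc alt_odd_binomial_sum_Suc)
qed

section \<open>Quotients of consecutive binomial coefficients\<close>

lemma binomial_3k_k_Suc:
  "(2 * k + 1) * (2 * k + 2) * ((3 * Suc k) choose Suc k) =
     3 * (3 * k + 1) * (3 * k + 2) * ((3 * k) choose k)"
proof -
  \<comment> \<open>With this factor both sides become the factorial of \<open>3 * k + 3\<close>, so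
    the binomial coefficients need no division.\<close>
  let ?F = "fact (Suc k) * fact (2 * k) :: nat"
  have "?F * ((2 * k + 1) * (2 * k + 2) * ((3 * Suc k) choose Suc k)) = fact (3 * Suc k)"
  proof -
    have "fact (Suc k) * fact (2 * Suc k) * ((3 * Suc k) choose Suc k) = fact (3 * Suc k)"
      using binomial_fact_lemma [of "Suc k" "3 * Suc k"] by simp
    moreover have "fact (2 * Suc k) = (2 * k + 1) * (2 * k + 2) * (fact (2 * k) :: nat)"
      by (simp add: algebra_simps)
    ultimately show ?thesis
      by (simp only: mult_ac)
  qed
  moreover have "?F * (3 * (3 * k + 1) * (3 * k + 2) * ((3 * k) choose k)) = fact (3 * Suc k)"
  proof -
    have "fact k * fact (2 * k) * ((3 * k) choose k) = fact (3 * k)"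
      using binomial_fact_lemma [of k "3 * k"] by simp
    moreover have "fact (3 * Suc k) = (3 * k + 3) * (3 * k + 1) * (3 * k + 2) * (fact (3 * k) :: nat)"
      by (simp add: numeral_3_eq_3 algebra_simps)
    moreover have "3 * fact (Suc k) = (3 * k + 3) * (fact k :: nat)"
      by (simp add: algebra_simps)
    moreover have "?F * (3 * (3 * k + 1) * (3 * k + 2) * ((3 * k) choose k)) =
        (3 * fact (Suc k)) * ((3 * k + 1) * (3 * k + 2)) * (fact (2 * k) * ((3 * k) choose k))"
      by (simp only: mult_ac)
    moreover have "(3 * k + 3) * fact k * ((3 * k + 1) * (3 * k + 2)) *
          (fact (2 * k) * ((3 * k) choose k)) =
        (3 * k + 3) * (3 * k + 1) * (3 * k + 2) * (fact k * fact (2 * k) * ((3 * k) choose k))"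
      by (simp only: mult_ac)
    ultimately show ?thesis
      by (simp only:)
  qed
  ultimately have "?F * ((2 * k + 1) * (2 * k + 2) * ((3 * Suc k) choose Suc k)) =
      ?F * (3 * (3 * k + 1) * (3 * k + 2) * ((3 * k) choose k))"
    by simp
  then show ?thesis
    by (simp only: mult_cancel_left) simp
qed

text \<open>Two absorption identities pass through the intermediate coefficient
  \<open>(n + k) choose (2 * k + 1)\<close>. The hypothesis \<open>k \<le> n\<close> turns the
  natural difference \<open>n - k\<close> into the integer one.\<close>

lemma binomial_add_2k_Suc:
  assumes "k \<le> n"
  shows "(2 * int k + 1) * (2 * int k + 2) * int ((n + Suc k) choose (2 * Suc k)) =
           (int n + int k + 1) * (int n - int k) * int ((n + k) choose (2 * k))"
proof -
  have "(2 * k + 2) * ((n + Suc k) choose (2 * Suc k)) =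
          (n + k + 1) * ((n + k) choose (2 * k + 1))"
    using Suc_times_binomial [of "2 * k + 1" "n + k"] by simp
  then have 1: "(2 * int k + 2) * int ((n + Suc k) choose (2 * Suc k)) =
          (int n + int k + 1) * int ((n + k) choose (2 * k + 1))"
    by (metis (no_types, opaque_lifting) of_nat_1 of_nat_add of_nat_mult of_nat_numeral)
  have "(2 * k + 1) * ((n + k) choose (2 * k + 1)) = (n - k) * ((n + k) choose (2 * k))"
    using binomial_absorb_comp [of "n + k" "2 * k"] binomial_absorption [of "2 * k" "n + k"] assms
    by simp
  then have 2: "(2 * int k + 1) * int ((n + k) choose (2 * k + 1)) =
          (int n - int k) * int ((n + k) choose (2 * k))"
    using assms
    by (metis (no_types, opaque_lifting) of_nat_1 of_nat_add of_nat_diff of_nat_mult of_nat_numeral)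
  have "(2 * int k + 1) * (2 * int k + 2) * int ((n + Suc k) choose (2 * Suc k)) =
          (int n + int k + 1) * ((2 * int k + 1) * int ((n + k) choose (2 * k + 1)))"
    by (simp only: 1 mult.assoc mult.left_commute [of "int n + int k + 1"])
  then show ?thesis
    by (simp only: 2 mult.assoc)
qed

text \<open>Induction on \<open>k\<close>: the quotients of consecutive terms on the two sides have
  the same denominator \<open>(2 * k + 1) * (2 * k + 2)\<close>, so it suffices to compare
  numerators and cancel the denominator modulo \<open>p\<close>.\<close>

lemma binomial_3k_k_cong:
  fixes p n k :: nat
  assumes "prime p" and p: "p = 3 * n + 1 \<or> p = 3 * n + 2" and "k \<le> n"
  shows "[int ((3 * k) choose k) = (- 27) ^ k * int ((n + k) choose (2 * k))] (mod int p)"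
  using \<open>k \<le> n\<close>
proof (induction k)
  case (Suc k)
  let ?d = "(2 * int k + 1) * (2 * int k + 2)"
  let ?B = "int ((n + k) choose (2 * k))"
  \<comment> \<open>As \<open>Suc k \<le> n\<close>, both factors of \<open>?d\<close> are at most
    \<open>2 * n\<close>, hence below \<open>p\<close>, and \<open>?d\<close> is invertible modulo
    \<open>p\<close>.\<close>
  have "coprime (int m) (int p)" if "0 < m" "m < p" for m
    using that \<open>prime p\<close> by (metis coprime_commute coprime_int_iff nat_dvd_not_less prime_imp_coprime)
  from this [of "2 * k + 1"] this [of "2 * k + 2"] have d: "coprime ?d (int p)"
    using Suc.prems p by (auto simp: add.commute)
  have "[3 * (3 * int k + 1) * (3 * int k + 2) = - 27 * (int n + int k + 1) * (int n - int k)]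
          (mod int p)"
  proof -
    \<comment> \<open>All terms in \<open>k\<close> cancel, and one of the remaining factors
      \<open>3 * n + 1\<close> and \<open>3 * n + 2\<close> is \<open>p\<close> itself.\<close>
    have "3 * (3 * int k + 1) * (3 * int k + 2) - - 27 * (int n + int k + 1) * (int n - int k) =
            3 * (3 * int n + 1) * (3 * int n + 2)"
      by (simp add: algebra_simps)
    moreover have "int p dvd 3 * (3 * int n + 1) * (3 * int n + 2)"
      using p
    proof
      assume "p = 3 * n + 1"
      then have "3 * int n + 1 = int p"
        by simp
      then show ?thesis
        by (simp only: dvd_mult dvd_mult2 dvd_refl)
    next
      assume "p = 3 * n + 2"
      then have "3 * int n + 2 = int p"
        by simp
      then show ?thesis
        by (simp only: dvd_mult dvd_refl)
    qed
    ultimately show ?thesis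
      by (simp only: cong_iff_dvd_diff)
  qed
  then have "[3 * (3 * int k + 1) * (3 * int k + 2) * int ((3 * k) choose k) =
      - 27 * (int n + int k + 1) * (int n - int k) * ((- 27) ^ k * ?B)] (mod int p)"
    by (rule cong_mult) (use Suc in simp)
  moreover have "3 * (3 * int k + 1) * (3 * int k + 2) * int ((3 * k) choose k) =
      ?d * int ((3 * Suc k) choose Suc k)"
    using arg_cong [OF binomial_3k_k_Suc [of k], of int]
    by (simp only: of_nat_mult of_nat_add of_nat_numeral of_nat_1)
  moreover have "- 27 * (int n + int k + 1) * (int n - int k) * ((- 27) ^ k * ?B) =
      ?d * ((- 27) ^ Suc k * int ((n + Suc k) choose (2 * Suc k)))"
  proof -
    have "?d * int ((n + Suc k) choose (2 * Suc k)) = (int n + int k + 1) * (int n - int k) * ?B"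
      using Suc.prems by (intro binomial_add_2k_Suc) simp
    then show ?thesis
      by (simp only: power_Suc mult_ac mult.left_commute [of ?d])
  qed
  ultimately show ?case
    using d by (simp only: cong_mult_lcancel)
qed simp

section \<open>From integer congruences to rational ones\<close>

lemma p_integral_divide:
  assumes "coprime b (int p)" and "b \<noteq> 0"
  shows "p_integral p (of_int a / of_int b)"
proof -
  obtain c d where q: "quotient_of (of_int a / of_int b) = (c, d)"
    by fastforce
  have "d > 0" "coprime c d"
    using quotient_of_denom_pos [OF q] quotient_of_coprime [OF q] .
  have "of_int a / of_int b = (of_int c / of_int d :: rat)"
    by (rule quotient_of_div [OF q])
  then have "of_int (a * d) = (of_int (c * b) :: rat)"
    using \<open>d > 0\<close> \<open>b \<noteq> 0\<close> by (simp add: field_simps)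
  then have "a * d = c * b"
    by (simp only: of_int_eq_iff)
  \<comment> \<open>The reduced denominator \<open>d\<close> divides any other denominator
    \<open>b\<close> of the same fraction, and so inherits coprimality to \<open>p\<close>.\<close>
  then have "d dvd c * b"
    by (metis dvd_triv_right)
  then have "d dvd b"
    using \<open>coprime c d\<close> by (simp add: coprime_commute coprime_dvd_mult_right_iff)
  then have "coprime d (int p)"
    using assms(1) by (rule coprime_divisors [OF _ dvd_refl])
  then show ?thesis
    by (simp add: p_integral_def q)
qed

text \<open>Clearing the denominator \<open>b\<close> loses nothing, as
  \<open>x - a = (N - b * a) / b\<close> and \<open>b\<close> is prime to \<open>p\<close>.\<close>

lemma rat_cong_of_intI:
  assumes "[N = b * a] (mod int p)" and "coprime b (int p)" and "b \<noteq> 0"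
    and x: "x = of_int N / of_int b"
  shows "rat_cong x (of_int a) p"
proof -
  obtain c where c: "N - b * a = int p * c"
    using assms(1) by (auto simp: cong_iff_dvd_diff)
  have "x - of_int a = of_int (N - b * a) / of_int b"
    using \<open>b \<noteq> 0\<close> by (simp add: x field_simps)
  also have "\<dots> = of_nat p * (of_int c / of_int b)"
    by (simp add: c)
  finally have "x - of_int a = of_nat p * (of_int c / of_int b)" .
  moreover have "p_integral p (of_int a)"
    using p_integral_divide [of 1 p a] by simp
  ultimately show ?thesis
    unfolding rat_cong_def using p_integral_divide [OF assms(2,3)] x by blast
qed

lemma rat_cong_binomial_sum:
  fixes p n :: nat
  assumes "prime p" and p: "p = 3 * n + 1 \<or> p = 3 * n + 2"
  shows "rat_cong (\<Sum>k\<le>n. of_nat ((3 * k) choose k) / 27 ^ k)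
           (of_int (alt_even_binomial_sum n)) p"
proof (rule rat_cong_of_intI)
  \<comment> \<open>The numerator of the sum over the common denominator
    \<open>27 ^ n\<close>.\<close>
  let ?N = "\<Sum>k\<le>n. 27 ^ (n - k) * int ((3 * k) choose k)"
  have "[?N = (\<Sum>k\<le>n. 27 ^ (n - k) * ((- 27) ^ k * int ((n + k) choose (2 * k))))] (mod int p)"
    using assms by (intro cong_sum cong_scalar_left binomial_3k_k_cong) auto
  also have "(\<Sum>k\<le>n. 27 ^ (n - k) * ((- 27) ^ k * int ((n + k) choose (2 * k)))) =
      27 ^ n * alt_even_binomial_sum n"
    unfolding alt_even_binomial_sum_def sum_distrib_left
  proof (rule sum.cong)
    fix k assume "k \<in> {..n}"
    then have "(27 :: int) ^ n = 27 ^ (n - k) * 27 ^ k"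
      by (simp flip: power_add)
    moreover have "(- 27 :: int) ^ k = 27 ^ k * (- 1) ^ k"
      by (simp flip: power_mult_distrib)
    ultimately show "27 ^ (n - k) * ((- 27) ^ k * int ((n + k) choose (2 * k))) =
        27 ^ n * ((- 1) ^ k * int ((n + k) choose (2 * k)))"
      by simp
  qed simp
  finally show "[?N = 27 ^ n * alt_even_binomial_sum n] (mod int p)" .
  have "coprime (3 :: nat) p"
  proof (rule primes_coprime)
    show "3 \<noteq> p"
      using p by presburger
  qed (use \<open>prime p\<close> in auto)
  \<comment> \<open>Writing \<open>27\<close> as \<open>3 ^ 3\<close> reduces coprimality to the
    distinct primes \<open>3\<close> and \<open>p\<close>.\<close>
  then have "coprime ((3 ^ 3) ^ n) p"
    by (intro coprime_power_left_iff [THEN iffD2] disjI1)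
  then have "coprime (int ((3 ^ 3) ^ n)) (int p)"
    by (simp only: coprime_int_iff)
  then show "coprime ((27 :: int) ^ n) (int p)"
    by simp
  show "(\<Sum>k\<le>n. of_nat ((3 * k) choose k) / 27 ^ k) = rat_of_int ?N / of_int (27 ^ n)"
    unfolding of_int_sum sum_divide_distrib
  proof (rule sum.cong)
    fix k assume "k \<in> {..n}"
    then have "(27 :: rat) ^ n = 27 ^ (n - k) * 27 ^ k"
      by (simp flip: power_add)
    then show "of_nat ((3 * k) choose k) / 27 ^ k =
        rat_of_int (27 ^ (n - k) * int ((3 * k) choose k)) / of_int (27 ^ n)"
      by simp
  qed simp
qed simp

theorem theorem3p2:
  fixes p :: nat
  assumes "prime p" and "p > 3"
  defines "S \<equiv> (\<Sum>k = 0..p div 3. of_nat ((3 * k) choose k) / 27 ^ k :: rat)"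
  shows "([int p = 1] (mod 9) \<or> [int p = - 1] (mod 9) \<longrightarrow> rat_cong S 1 p) \<and>
         ([int p = 2] (mod 9) \<or> [int p = - 2] (mod 9) \<longrightarrow> rat_cong S (- 1) p) \<and>
         ([int p = 4] (mod 9) \<or> [int p = - 4] (mod 9) \<longrightarrow> rat_cong S 0 p)"
proof -
  define n where "n = p div 3"
  have "odd p"
    using assms prime_odd_nat by auto
  have "\<not> 3 dvd p"
    using assms by (auto simp: prime_nat_iff)
  then have p: "p = 3 * n + 1 \<or> p = 3 * n + 2"
    unfolding n_def by presburger
  have cong: "rat_cong S (of_int (alt_even_binomial_sum (n mod 6))) p"
    using rat_cong_binomial_sum [OF assms(1) p]
    by (simp add: S_def n_def atLeast0AtMost flip: alt_even_binomial_sum_mod_6)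
  have residue: "[int p = 1] (mod 9) \<or> [int p = - 1] (mod 9) \<Longrightarrow> p mod 9 = 1 \<or> p mod 9 = 8"
    "[int p = 2] (mod 9) \<or> [int p = - 2] (mod 9) \<Longrightarrow> p mod 9 = 2 \<or> p mod 9 = 7"
    "[int p = 4] (mod 9) \<or> [int p = - 4] (mod 9) \<Longrightarrow> p mod 9 = 4 \<or> p mod 9 = 5"
    unfolding cong_def using zmod_int [of p 9] by (simp; linarith)+
  define r where "r = n mod 6"
  have n: "n = r + 6 * (n div 6)"
    by (simp add: r_def)
  have "r \<in> {0, 1, 2, 3, 4, 5}"
    by (auto simp: r_def)
  \<comment> \<open>Since \<open>p\<close> is odd, \<open>n\<close> is even in the case
    \<open>3 * n + 1\<close> and odd in the case \<open>3 * n + 2\<close>. The remainder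
    \<open>r\<close> has the parity of \<open>n\<close>, and \<open>3 * n\<close> differs from
    \<open>3 * r\<close> by a multiple of 18, hence of 9.\<close>
  moreover have "even r \<and> p mod 9 = (3 * r + 1) mod 9 \<or> odd r \<and> p mod 9 = (3 * r + 2) mod 9"
    using p
  proof
    assume "p = 3 * n + 1"
    then have "p = 3 * r + 1 + 9 * (2 * (n div 6))"
      using n by linarith
    then show ?thesis
      using \<open>odd p\<close> by (metis dvd_triv_left even_add even_mult_iff mod_mult_self2 odd_numeral odd_one)
  next
    assume "p = 3 * n + 2"
    then have "p = 3 * r + 2 + 9 * (2 * (n div 6))"
      using n by linarith
    then show ?thesis
      using \<open>odd p\<close> by (metis dvd_triv_left even_add even_mult_iff mod_mult_self2 dvd_refl)
  qed
  \<comment> \<open>The six values of \<open>r\<close> match the six classes prime to 9; the pairs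
    \<open>{0, 5}\<close>, \<open>{2, 3}\<close>, \<open>{1, 4}\<close> are where the periodic sum
    takes the values 1, -1, 0.\<close>
  ultimately have "p mod 9 = 1 \<and> r = 0 \<or> p mod 9 = 8 \<and> r = 5 \<or> p mod 9 = 2 \<and> r = 3 \<or>
      p mod 9 = 7 \<and> r = 2 \<or> p mod 9 = 4 \<and> r = 4 \<or> p mod 9 = 5 \<and> r = 1"
    by auto
  then have "rat_cong S (if p mod 9 = 1 \<or> p mod 9 = 8 then 1
      else if p mod 9 = 2 \<or> p mod 9 = 7 then - 1 else 0) p"
    using cong unfolding r_def [symmetric]
    by (elim disjE conjE) (simp_all add: alt_even_binomial_sum_initial_values del: One_nat_def)
  then show ?thesis
    using residue by (intro conjI impI) (force split: if_splits)+
qed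

end
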